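(* If $z^*=(x^*,y^* )$ is an optimal solution (global minimizer) of the problem $\min\{f(z):z\in F\}$, then $z^*$ is an $N^C$-stationary point of this problem, and $z^*$ is also a $T^C$-stationary point of this problem.
   Context: $l,m,n,s,t$ are positive integers with $s<m$, $t<n$; $\mathscr{A}=(a_{ijk})\in\mathbb{R}^{l\times m\times n}$ and $b\in\mathbb{R}^l$ are given. For $x\in\mathbb{R}^m$, $y\in\mathbb{R}^n$, $\mathscr{A}xy\in\mathbb{R}^l$ has entries $(\mathscr{A}xy)_i=\sum_{j,k}a_{ijk}x_jy_k$, and $f(z)=f(x,y)=\frac12\|\mathscr{A}xy-b\|^2$ for $z=(x,y)\in\mathbb{R}^{m+n}$. $\|\cdot\|_0$ counts nonzero entries. For $x\ne0$, $\gamma_x$ is the index of the first nonzero entry of $x$. $F_1=\{x\in\mathbb{R}^m:\|x\|_0\le s,\ e_{\gamma_x}^\top x=1\}$ (nonzero vectors with at most $s$ nonzero entries and first nonzero entry equal to $1$), $F_2=\{y\in\mathbb{R}^n:\|y\|_0\le t\}$, $F=F_1\times F_2$. Clarke cones: for nonempty $S\subseteq\mathbb{R}^p$ and $x\in S$, $T^C_S(x)$ is the set of all $d$ such that for any $\{x^k\}\subset S$ with $x^k\to x$ and any $\{\lambda_k\}\subset\mathbb{R}_+$ with $\lambda_k\to0$, there exists $y^k\to d$ with $x^k+\lambda_ky^k\in S$ for all $k$; $N^C_S(x)=\{d:\langle d,u\rangle\le0\ \forall u\in T^C_S(x)\}$. For $z^*\in F$: $z^*$ is $N^C$-stationary if $-\nabla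 f(z^* )\in N^C_F(z^* )$; $z^*$ is $T^C$-stationary if $\|\nabla^C_Ff(z^* )\|=0$, where $\nabla^C_Ff(z^* ):=\mathrm{argmin}\{\|\nabla f(z^* )+d\|:d\in T^C_F(z^* )\}$ (i.e. the minimizer is $d=0$). *)

theory Defs
  imports "HOL-Analysis.Analysis"
begin

definition l0norm :: "real ^ 'n \<Rightarrow> nat" where
  "l0norm x = card {i. x $ i \<noteq> 0}"

text \<open>The index types that stand for \<open>{1..m}\<close> carry a linear order, needed to speak of
  the first nonzero entry.\<close>

definition first_nz :: "real ^ ('m::{finite,linorder}) \<Rightarrow> 'm" where
  "first_nz x = (LEAST i. x $ i \<noteq> 0)"

definition F1 :: "nat \<Rightarrow> (real ^ ('m::{finite,linorder})) set" where
  "F1 s = {x. x \<noteq> 0 \<and> l0norm x \<le> s \<and> axis (first_nz x) 1 \<bullet> x = 1}"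

definition F2 :: "nat \<Rightarrow> (real ^ 'n) set" where
  "F2 t = {y. l0norm y \<le> t}"

definition feasible :: "nat \<Rightarrow> nat \<Rightarrow> ((real ^ ('m::{finite,linorder})) \<times> (real ^ 'n)) set" where
  "feasible s t = F1 s \<times> F2 t"

definition tensor_apply :: "real ^ 'n ^ 'm ^ 'l \<Rightarrow> real ^ 'm \<Rightarrow> real ^ 'n \<Rightarrow> real ^ 'l" where
  "tensor_apply A x y = (\<chi> i. \<Sum>j\<in>UNIV. \<Sum>k\<in>UNIV. A $ i $ j $ k * x $ j * y $ k)"

text \<open>\<open>\<real>\<^sup>m\<^sup>+\<^sup>n\<close> is the product space; its inner product and norm are the Euclidean ones.\<close>

definition objective :: "real ^ 'n ^ 'm ^ 'l \<Rightarrow> real ^ 'l \<Rightarrow> (real ^ 'm) \<times> (real ^ 'n) \<Rightarrow> real" where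
  "objective A b z = 1 / 2 * (norm (tensor_apply A (fst z) (snd z) - b))\<^sup>2"

definition gradient :: "('a::real_inner \<Rightarrow> real) \<Rightarrow> 'a \<Rightarrow> 'a" where
  "gradient f x = (THE D. GDERIV f x :> D)"

lemma gradient_eqI:
  assumes "GDERIV f x :> D"
  shows "gradient f x = D"
  unfolding gradient_def
proof (rule the_equality)
  show "GDERIV f x :> D" by (rule assms)
next
  fix E assume "GDERIV f x :> E"
  then have "(\<lambda>h. inner h E) = (\<lambda>h. inner h D)"
    using assms unfolding gderiv_def by (rule has_derivative_unique)
  then have "inner h (E - D) = 0" for h
    by (metis inner_diff_right right_minus_eq)
  then show "E = D"
    using inner_eq_zero_iff right_minus_eq by blast
qed

lemma tensor_apply_bilinear: "bounded_bilinear (tensor_apply A)"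
proof -
  have "bilinear (tensor_apply A)"
    unfolding bilinear_def
    by (auto intro!: linearI simp: tensor_apply_def vec_eq_iff algebra_simps sum.distrib sum_distrib_left)
  then show ?thesis
    by (simp add: bilinear_conv_bounded_bilinear)
qed

lemma objective_gderiv: "GDERIV (objective A b) z :> gradient (objective A b) z"
proof -
  interpret bounded_bilinear "tensor_apply A" by (rule tensor_apply_bilinear)
  have fst: "(fst has_derivative fst) (at z)" and snd: "(snd has_derivative snd) (at z)"
    by (rule bounded_linear_imp_has_derivative, rule bounded_linear_fst bounded_linear_snd)+
  note 1 = has_derivative_diff[OF FDERIV[OF fst snd] has_derivative_const[of b]]
  have "\<exists>f'. (objective A b has_derivative f') (at z)"
    unfolding objective_def[abs_def] power2_norm_eq_inner
    using has_derivative_mult_right[OF has_derivative_inner[OF 1 1], of "1 / 2"] by blast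
  then obtain f' where f': "(objective A b has_derivative f') (at z)" by blast
  interpret f': linear f' using f' by (rule has_derivative_linear)
  have "f' h = inner h (adjoint f' 1)" for h
    using adjoint_works[OF f'.linear_axioms, of h 1] by simp
  then have "GDERIV (objective A b) z :> adjoint f' 1"
    using f' unfolding gderiv_def by (metis ext)
  then show ?thesis using gradient_eqI by metis
qed

definition clarke_tangent_cone :: "('a::euclidean_space) set \<Rightarrow> 'a \<Rightarrow> 'a set" where
  "clarke_tangent_cone S x =
    {d. \<forall>X L. (\<forall>k. X k \<in> S) \<longrightarrow> X \<longlonglongrightarrow> x \<longrightarrow> (\<forall>k. (0::real) \<le> L k) \<longrightarrow> L \<longlonglongrightarrow> 0 \<longrightarrow>
          (\<exists>Y. Y \<longlonglongrightarrow> d \<and> (\<forall>k::nat. X k + L k *\<^sub>R Y k \<in> S))}"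

definition clarke_normal_cone :: "('a::euclidean_space) set \<Rightarrow> 'a \<Rightarrow> 'a set" where
  "clarke_normal_cone S x = {d. \<forall>u\<in>clarke_tangent_cone S x. d \<bullet> u \<le> 0}"

text \<open>The minimizer below exists and is unique: see \<open>clarke_gradient_unique\<close>.\<close>

definition clarke_gradient :: "('a::euclidean_space) set \<Rightarrow> ('a \<Rightarrow> real) \<Rightarrow> 'a \<Rightarrow> 'a" where
  "clarke_gradient S f z =
    arg_min (\<lambda>d. norm (gradient f z + d)) (\<lambda>d. d \<in> clarke_tangent_cone S z)"

definition NC_stationary :: "('a::euclidean_space) set \<Rightarrow> ('a \<Rightarrow> real) \<Rightarrow> 'a \<Rightarrow> bool" where
  "NC_stationary S f z \<longleftrightarrow> z \<in> S \<and> - gradient f z \<in> clarke_normal_cone S z"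

definition TC_stationary :: "('a::euclidean_space) set \<Rightarrow> ('a \<Rightarrow> real) \<Rightarrow> 'a \<Rightarrow> bool" where
  "TC_stationary S f z \<longleftrightarrow> z \<in> S \<and> norm (clarke_gradient S f z) = 0"

lemma zero_in_clarke_tangent_cone: "0 \<in> clarke_tangent_cone S x"
  unfolding clarke_tangent_cone_def by (auto intro!: exI[of _ "\<lambda>_. 0"])

lemma clarke_tangent_coneE:
  assumes "d \<in> clarke_tangent_cone S x" "\<forall>k. X k \<in> S" "X \<longlonglongrightarrow> x"
    "\<forall>k. (0::real) \<le> L k" "L \<longlonglongrightarrow> 0"
  obtains Y where "Y \<longlonglongrightarrow> d" "\<forall>k::nat. X k + L k *\<^sub>R Y k \<in> S"
  using assms unfolding clarke_tangent_cone_def by blast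

lemma clarke_tangent_cone_convex: "convex (clarke_tangent_cone S x)"
proof -
  let ?T = "clarke_tangent_cone S x"
  have cone: "a *\<^sub>R d \<in> ?T" if d: "d \<in> ?T" and a: "0 \<le> a" for a d
    unfolding clarke_tangent_cone_def
  proof (intro CollectI allI impI)
    fix X L assume X: "\<forall>k. X k \<in> S" "X \<longlonglongrightarrow> x" and L: "\<forall>k. (0::real) \<le> L k" "L \<longlonglongrightarrow> 0"
    have "\<forall>k. 0 \<le> L k * a" "(\<lambda>k. L k * a) \<longlonglongrightarrow> 0"
      using L a by (auto intro: tendsto_mult_left_zero)
    then obtain Y where Y: "Y \<longlonglongrightarrow> d" "\<forall>k. X k + (L k * a) *\<^sub>R Y k \<in> S"
      using clarke_tangent_coneE[OF d X, of "\<lambda>k. L k * a"] by blast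
    show "\<exists>Y. Y \<longlonglongrightarrow> a *\<^sub>R d \<and> (\<forall>k. X k + L k *\<^sub>R Y k \<in> S)"
      using Y by (intro exI[of _ "\<lambda>k. a *\<^sub>R Y k"]) (auto intro!: tendsto_intros)
  qed
  have sum: "d + e \<in> ?T" if d: "d \<in> ?T" and e: "e \<in> ?T" for d e
    unfolding clarke_tangent_cone_def
  proof (intro CollectI allI impI)
    fix X L assume X: "\<forall>k. X k \<in> S" "X \<longlonglongrightarrow> x" and L: "\<forall>k. (0::real) \<le> L k" "L \<longlonglongrightarrow> 0"
    obtain Y where Y: "Y \<longlonglongrightarrow> d" "\<forall>k. X k + L k *\<^sub>R Y k \<in> S"
      using clarke_tangent_coneE[OF d X L] by blast
    have "(\<lambda>k. X k + L k *\<^sub>R Y k) \<longlonglongrightarrow> x + 0 *\<^sub>R d"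
      using X L Y by (intro tendsto_intros)
    then have XY: "(\<lambda>k. X k + L k *\<^sub>R Y k) \<longlonglongrightarrow> x" by simp
    obtain Z where Z: "Z \<longlonglongrightarrow> e" "\<forall>k. (X k + L k *\<^sub>R Y k) + L k *\<^sub>R Z k \<in> S"
      using clarke_tangent_coneE[OF e Y(2) XY L] by blast
    show "\<exists>Y. Y \<longlonglongrightarrow> d + e \<and> (\<forall>k. X k + L k *\<^sub>R Y k \<in> S)"
      using Y Z by (intro exI[of _ "\<lambda>k. Y k + Z k"])
        (auto intro!: tendsto_intros simp: scaleR_add_right add.assoc)
  qed
  show ?thesis by (intro convexI sum cone)
qed

lemma clarke_tangent_cone_closed: "closed (clarke_tangent_cone S x)"
  unfolding closed_sequential_limits
proof (intro allI impI, elim conjE)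
  fix D d assume D: "\<forall>j. D j \<in> clarke_tangent_cone S x" "D \<longlonglongrightarrow> d"
  show "d \<in> clarke_tangent_cone S x"
    unfolding clarke_tangent_cone_def
  proof (intro CollectI allI impI)
    fix X L assume X: "\<forall>k. X k \<in> S" "X \<longlonglongrightarrow> x" and L: "\<forall>k. (0::real) \<le> L k" "L \<longlonglongrightarrow> 0"
    define Q where "Q k = {y. X k + L k *\<^sub>R y \<in> S}" for k
    have ne: "Q k \<noteq> {}" for k
      using X unfolding Q_def by (auto intro!: exI[of _ 0])
    have lim: "(\<lambda>k. infdist d (Q k)) \<longlonglongrightarrow> 0"
    proof (rule LIMSEQ_I)
      fix r :: real assume r: "0 < r"
      obtain j where j: "dist (D j) d < r / 2"
        using D(2) r unfolding lim_sequentially by (meson half_gt_zero le_refl)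
      obtain Y where Y: "Y \<longlonglongrightarrow> D j" "\<forall>k. X k + L k *\<^sub>R Y k \<in> S"
        using clarke_tangent_coneE[OF D(1)[rule_format] X L] by blast
      obtain N where N: "\<forall>k\<ge>N. dist (Y k) (D j) < r / 2"
        using Y(1) r unfolding lim_sequentially by (meson half_gt_zero)
      have "norm (infdist d (Q k) - 0) < r" if "k \<ge> N" for k
      proof -
        have "infdist d (Q k) \<le> dist d (Y k)"
          using Y(2) by (intro infdist_le) (simp add: Q_def)
        also have "\<dots> \<le> dist d (D j) + dist (D j) (Y k)" by (rule dist_triangle)
        also have "\<dots> < r" using j N that by (smt (verit) dist_commute field_sum_of_halves)
        finally show ?thesis by (simp add: infdist_nonneg)
      qed
      then show "\<exists>N. \<forall>k\<ge>N. norm (infdist d (Q k) - 0) < r" by blast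
    qed
    have "\<exists>y\<in>Q k. dist d y < infdist d (Q k) + inverse (real (Suc k))" for k
    proof (rule ccontr)
      assume "\<not> ?thesis"
      then have "infdist d (Q k) + inverse (real (Suc k)) \<le> infdist d (Q k)"
        unfolding infdist_notempty[OF ne, of d k]
        by (intro cINF_greatest ne) (auto simp: not_less)
      then show False by simp
    qed
    then obtain Y where Y: "\<And>k. Y k \<in> Q k"
      "\<And>k. dist d (Y k) < infdist d (Q k) + inverse (real (Suc k))" by metis
    have "(\<lambda>k. infdist d (Q k) + inverse (real (Suc k))) \<longlonglongrightarrow> 0"
      using tendsto_add[OF lim LIMSEQ_inverse_real_of_nat] by simp
    then have "(\<lambda>k. dist (Y k) d) \<longlonglongrightarrow> 0"
      by (rule tendsto_sandwich[OF _ _ tendsto_const, rotated 2])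
        (auto simp: dist_commute[of _ d] simp del: of_nat_Suc
          intro!: always_eventually less_imp_le[OF Y(2)])
    then have "Y \<longlonglongrightarrow> d" using tendsto_dist_iff by blast
    then show "\<exists>Y. Y \<longlonglongrightarrow> d \<and> (\<forall>k. X k + L k *\<^sub>R Y k \<in> S)"
      using Y(1) unfolding Q_def by blast
  qed
qed

lemma clarke_gradient_unique:
  "\<exists>!d. is_arg_min (\<lambda>d. norm (gradient f z + d)) (\<lambda>d. d \<in> clarke_tangent_cone S z) d"
proof -
  let ?T = "clarke_tangent_cone S z" and ?g = "gradient f z"
  have eq: "norm (?g + d) = dist (- ?g) d" for d
    by (simp add: dist_norm norm_minus_commute[of "- ?g"] add.commute)
  obtain d where d: "d \<in> ?T" "\<forall>y\<in>?T. dist (- ?g) d \<le> dist (- ?g) y"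
  proof (rule distance_attains_inf[OF clarke_tangent_cone_closed, of S z "- ?g"])
    show "?T \<noteq> {}" using zero_in_clarke_tangent_cone[of S z] by force
  qed blast
  show ?thesis
  proof (rule ex1I)
    show "is_arg_min (\<lambda>d. norm (?g + d)) (\<lambda>d. d \<in> ?T) d"
      using d by (auto simp: is_arg_min_linorder eq)
  next
    fix e assume "is_arg_min (\<lambda>d. norm (?g + d)) (\<lambda>d. d \<in> ?T) e"
    then have "e \<in> ?T" "\<forall>y\<in>?T. dist (- ?g) e \<le> dist (- ?g) y"
      by (auto simp: is_arg_min_linorder eq)
    then show "e = d"
      using any_closest_point_unique[OF clarke_tangent_cone_convex clarke_tangent_cone_closed] d
      by metis
  qed
qed

end

theory Submission imports Defs begin

text \<open>
  Both conclusions are first-order conditions that hold for a differentiable function \<open>f\<close> at a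
  minimizer \<open>z\<close> over an arbitrary set \<open>S\<close>.

  Every direction \<open>u\<close> in the Clarke cone can be reached from \<open>z\<close> itself: with the constant
  base sequence \<open>z\<close> and step lengths \<open>1 / (k + 1)\<close> there are feasible points
  \<open>z + Y k / (k + 1)\<close> with \<open>Y k \<longlonglongrightarrow> u\<close>. As \<open>f\<close> does not decrease at these points, its
  directional derivative along \<open>u\<close> is nonnegative
  (\<open>minimizer_imp_inner_gradient_nonneg\<close>). This inequality for all \<open>u\<close> in the cone is
  precisely the statement that minus the gradient \<open>g\<close> lies in the polar cone, which is
  normal-cone stationarity. It also gives
  \<open>\<parallel>g + u\<parallel>\<^sup>2 = \<parallel>g\<parallel>\<^sup>2 + 2 (g \<bullet> u) + \<parallel>u\<parallel>\<^sup>2 \<ge> \<parallel>g\<parallel>\<^sup>2\<close>, so \<open>u = 0\<close> is the point of the cone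
  that minimizes \<open>\<parallel>g + u\<parallel>\<close>, which is tangent-cone stationarity.
\<close>

text \<open>
  The differentiability estimate at \<open>z + L k *\<^sub>R Y k\<close>, divided by the step length \<open>L k\<close>, gives
  \<open>0 \<le> Y k \<bullet> g + e * norm (Y k)\<close> for each \<open>e > 0\<close> and all large \<open>k\<close>; then \<open>k\<close> tends to
  infinity and \<open>e\<close> becomes small.
\<close>

lemma minimizer_imp_inner_gradient_nonneg:
  fixes f :: "'a::euclidean_space \<Rightarrow> real"
  assumes deriv: "GDERIV f z :> g"
    and z: "z \<in> S" and min: "\<And>w. w \<in> S \<Longrightarrow> f z \<le> f w"
    and u: "u \<in> clarke_tangent_cone S z"
  shows "0 \<le> g \<bullet> u"
proof -
  define L :: "nat \<Rightarrow> real" where "L k = inverse (real (Suc k))" for k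
  have Lpos: "0 < L k" for k
    by (simp add: L_def)
  have Llim: "L \<longlonglongrightarrow> 0"
    unfolding L_def by (rule LIMSEQ_inverse_real_of_nat)
  obtain Y where Y: "Y \<longlonglongrightarrow> u" "\<forall>k. z + L k *\<^sub>R Y k \<in> S"
    by (rule clarke_tangent_coneE[OF u, of "\<lambda>_. z" L])
      (simp_all add: z Llim less_imp_le[OF Lpos])
  have step: "(\<lambda>k. L k *\<^sub>R Y k) \<longlonglongrightarrow> 0"
    using tendsto_scaleR[OF Llim Y(1)] by simp
  have approx: "0 \<le> u \<bullet> g + e * norm u" if e: "0 < e" for e
  proof -
    obtain r where r: "0 < r"
      "\<And>w. norm (w - z) < r \<Longrightarrow> \<bar>f w - f z - (w - z) \<bullet> g\<bar> \<le> e * norm (w - z)"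
      using deriv e unfolding gderiv_def has_derivative_at_alt real_norm_def by blast
    have "eventually (\<lambda>k. norm (L k *\<^sub>R Y k) < r) sequentially"
      using step r(1) by (simp add: tendsto_iff)
    then have "eventually (\<lambda>k. 0 \<le> Y k \<bullet> g + e * norm (Y k)) sequentially"
    proof eventually_elim
      case (elim k)
      have "f z \<le> f (z + L k *\<^sub>R Y k)"
        using Y(2) min by blast
      with r(2)[of "z + L k *\<^sub>R Y k"] elim
      have "0 \<le> L k * (Y k \<bullet> g + e * norm (Y k))"
        using Lpos[of k] by (simp add: algebra_simps)
      then show ?case
        using Lpos[of k] by (simp add: zero_le_mult_iff)
    qed
    moreover have "(\<lambda>k. Y k \<bullet> g + e * norm (Y k)) \<longlonglongrightarrow> u \<bullet> g + e * norm u"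
      by (intro tendsto_intros Y(1))
    ultimately show ?thesis
      by (intro tendsto_lowerbound[OF _ _ sequentially_bot])
  qed
  have "0 \<le> u \<bullet> g"
  proof (rule ccontr)
    assume "\<not> 0 \<le> u \<bullet> g"
    then have neg: "u \<bullet> g < 0" by simp
    have n1: "0 < norm u + 1"
      by (simp add: add_nonneg_pos)
    \<comment> \<open>This \<open>e\<close> makes \<open>u \<bullet> g + e * norm u\<close> equal to minus \<open>e\<close>.\<close>
    define e where "e = - (u \<bullet> g) / (norm u + 1)"
    have "0 < e"
      using neg n1 by (simp add: e_def field_simps)
    moreover have "u \<bullet> g = - e * (norm u + 1)"
      using n1 by (simp add: e_def)
    ultimately show False
      using approx[of e] by (simp add: algebra_simps)
  qed
  then show ?thesis by (simp add: inner_commute)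
qed

text \<open>
  The defining choice operator is pinned down by uniqueness of the nearest point of a closed
  convex set, so it suffices that \<open>0\<close> is a minimizer.
\<close>

lemma clarke_gradient_eq_0I:
  assumes "\<And>u. u \<in> clarke_tangent_cone S z \<Longrightarrow> 0 \<le> gradient f z \<bullet> u"
  shows "clarke_gradient S f z = 0"
proof -
  let ?P = "is_arg_min (\<lambda>d. norm (gradient f z + d)) (\<lambda>d. d \<in> clarke_tangent_cone S z)"
  have "norm (gradient f z) \<le> norm (gradient f z + u)" if "u \<in> clarke_tangent_cone S z" for u
    unfolding norm_le using assms[OF that]
    by (simp add: inner_add_left inner_add_right inner_commute[of u "gradient f z"])
  then have zero: "?P 0"
    by (auto simp: is_arg_min_linorder zero_in_clarke_tangent_cone)
  moreover have "?P (clarke_gradient S f z)"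
    unfolding clarke_gradient_def arg_min_def using zero by (rule someI)
  ultimately show ?thesis
    using clarke_gradient_unique[of f z S] by blast
qed

theorem theorem3p10:
  fixes A :: "real ^ 'n ^ ('m::{finite,linorder}) ^ 'l"
    and b :: "real ^ 'l"
    and s t :: nat
    and xs :: "real ^ ('m::{finite,linorder})" and ys :: "real ^ 'n"
  assumes "0 < s" and "s < CARD('m)"
    and "0 < t" and "t < CARD('n)"
    and "is_arg_min (objective A b) (\<lambda>z. z \<in> feasible s t) (xs, ys)"
  shows "NC_stationary (feasible s t) (objective A b) (xs, ys)
       \<and> TC_stationary (feasible s t) (objective A b) (xs, ys)"
proof -
  have z: "(xs, ys) \<in> feasible s t"
    and min: "\<And>w. w \<in> feasible s t \<Longrightarrow> objective A b (xs, ys) \<le> objective A b w"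
    using assms(5) by (auto simp: is_arg_min_linorder)
  have nonneg: "0 \<le> gradient (objective A b) (xs, ys) \<bullet> u"
    if "u \<in> clarke_tangent_cone (feasible s t) (xs, ys)" for u
    using objective_gderiv z min that by (rule minimizer_imp_inner_gradient_nonneg)
  then have "clarke_gradient (feasible s t) (objective A b) (xs, ys) = 0"
    by (rule clarke_gradient_eq_0I)
  then show ?thesis
    using z nonneg by (simp add: NC_stationary_def TC_stationary_def clarke_normal_cone_def)
qed

end
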